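(* The following operational formula holds for an appropriate function $f$: $$\widehat{M}^{n}f(x)=\sum_{k=0}^{n}\binom{n}{k}\,\phi_{n-k}(x)\,(xD)^{k}f(x),$$ where $\widehat{M}=x+xD$.
   Context: $n$ is a nonnegative integer. $D=\frac{d}{dx}$; $xD$ is the operator $f(x)\mapsto x f'(x)$, and $\widehat M=x+xD$ is the operator $f(x)\mapsto x f(x)+x f'(x)$. Powers of operators mean iterated composition, with zeroth power the identity. The exponential polynomials are $\phi_n(x)=\sum_{k=0}^{n}\genfrac{\{}{\}}{0pt}{}{n}{k}x^k$, where $\genfrac{\{}{\}}{0pt}{}{n}{k}$ are the Stirling numbers of the second kind. The class of "appropriate" functions $f$ is not specified further in the source. *)

theory Defs
  imports "HOL-Analysis.Analysis" "HOL-Combinatorics.Stirling"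
begin

definition xD_op :: "('a::real_normed_field \<Rightarrow> 'a) \<Rightarrow> ('a \<Rightarrow> 'a)" where
  "xD_op f = (\<lambda>x. x * deriv f x)"

definition M_hat :: "('a::real_normed_field \<Rightarrow> 'a) \<Rightarrow> ('a \<Rightarrow> 'a)" where
  "M_hat f = (\<lambda>x. x * f x + xD_op f x)"

definition exp_polynomial :: "nat \<Rightarrow> 'a::comm_semiring_1 \<Rightarrow> 'a" where
  "exp_polynomial n x = (\<Sum>k=0..n. of_nat (Stirling n k) * x ^ k)"

end

theory Submission
  imports Defs
begin

text \<open>
  The operator \<open>M_hat\<close> obeys the product rule
  \<open>M_hat (u * g) = M_hat u * g + u * xD_op g\<close>, and the Stirling recurrence says precisely that
  \<open>M_hat\<close> sends each exponential polynomial to the next one. Hence the formula follows by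
  induction on \<open>n\<close> from Pascal's rule. The regularity of the iterates \<open>(xD_op ^^ k) f\<close> comes from
  the Leibniz formula for the derivatives of \<open>x * f' x\<close>.
\<close>

lemma has_field_derivative_cong_on_open:
  fixes f g :: "'a::real_normed_field \<Rightarrow> 'a"
  assumes "open S" "x \<in> S" "\<And>y. y \<in> S \<Longrightarrow> f y = g y" "(g has_field_derivative d) (at x)"
  shows "(f has_field_derivative d) (at x)"
  using has_field_derivative_transform_within_open[OF assms(4,1,2)] assms(3) by simp

text \<open>In the Leibniz formula for \<open>y * deriv f y\<close> only two terms survive, because
  the second derivative of the factor \<open>y\<close> vanishes. Each induction step differentiates
  an identity known on all of the open set \<open>S\<close>.\<close>

lemma deriv_funpow_xD_op:
  fixes f :: "'a::real_normed_field \<Rightarrow> 'a"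
  assumes "open S"
    and diff: "\<And>k y. k \<le> m \<Longrightarrow> y \<in> S \<Longrightarrow> (deriv ^^ k) f field_differentiable (at y)"
    and "k \<le> m" "y \<in> S"
  shows "(deriv ^^ k) (xD_op f) y = y * (deriv ^^ Suc k) f y + of_nat k * (deriv ^^ k) f y"
  using \<open>k \<le> m\<close> \<open>y \<in> S\<close>
proof (induction k arbitrary: y)
  case 0
  then show ?case by (simp add: xD_op_def)
next
  case (Suc k)
  have d: "((deriv ^^ j) f has_field_derivative (deriv ^^ Suc j) f y) (at y)" if "j \<le> m" for j
    using diff[OF that Suc.prems(2)] by (simp add: field_differentiable_derivI)
  have "((\<lambda>y. y * (deriv ^^ Suc k) f y + of_nat k * (deriv ^^ k) f y) has_field_derivative
      y * (deriv ^^ Suc (Suc k)) f y + of_nat (Suc k) * (deriv ^^ Suc k) f y) (at y)"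
    using Suc.prems(1)
    by (auto intro!: derivative_eq_intros d simp del: funpow.simps simp: algebra_simps)
  then have "((deriv ^^ k) (xD_op f) has_field_derivative
      y * (deriv ^^ Suc (Suc k)) f y + of_nat (Suc k) * (deriv ^^ Suc k) f y) (at y)"
    using has_field_derivative_cong_on_open[OF \<open>open S\<close> Suc.prems(2) Suc.IH] Suc.prems(1)
    by simp
  then show ?case by (simp add: DERIV_imp_deriv)
qed

text \<open>The Leibniz formula for order \<open>k\<close> contains the derivative of
  \<open>f\<close> of order \<open>Suc k\<close>, so one order of differentiability is lost; hence
  the strict bound \<open>k < m\<close>.\<close>

lemma deriv_funpow_xD_op_differentiable:
  fixes f :: "'a::real_normed_field \<Rightarrow> 'a"
  assumes "open S"
    and diff: "\<And>k y. k \<le> m \<Longrightarrow> y \<in> S \<Longrightarrow> (deriv ^^ k) f field_differentiable (at y)"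
    and "k < m" "y \<in> S"
  shows "(deriv ^^ k) (xD_op f) field_differentiable (at y)"
proof -
  have eq: "(deriv ^^ k) (xD_op f) z = z * (deriv ^^ Suc k) f z + of_nat k * (deriv ^^ k) f z"
    if "z \<in> S" for z
    by (rule deriv_funpow_xD_op[OF \<open>open S\<close> diff]) (use \<open>k < m\<close> that in auto)
  have "(\<lambda>y. y * (deriv ^^ Suc k) f y + of_nat k * (deriv ^^ k) f y) field_differentiable (at y)"
    using assms by (intro derivative_intros diff) auto
  then show ?thesis
    unfolding field_differentiable_def
    by (elim ex_forward) (rule has_field_derivative_cong_on_open[OF \<open>open S\<close> \<open>y \<in> S\<close> eq])
qed

lemma xD_op_funpow_differentiable:
  fixes f :: "'a::real_normed_field \<Rightarrow> 'a"
  assumes "open S"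
    and "\<And>j y. j < n \<Longrightarrow> y \<in> S \<Longrightarrow> (deriv ^^ j) f field_differentiable (at y)"
    and "k < n" "y \<in> S"
  shows "(xD_op ^^ k) f field_differentiable (at y)"
  using assms(2-)
proof (induction k arbitrary: f n)
  case 0
  then show ?case using "0.prems"(1)[of 0] by simp
next
  case (Suc k)
  \<comment> \<open>The innermost \<open>xD_op\<close> is split off, so the induction hypothesis
    applies to \<open>xD_op f\<close>, for which one order fewer is available: \<open>n - 1\<close>
    instead of \<open>n\<close>.\<close>
  have "(xD_op ^^ k) (xD_op f) field_differentiable (at y)"
  proof (rule Suc.IH)
    fix j z assume "j < n - 1" "z \<in> S"
    then show "(deriv ^^ j) (xD_op f) field_differentiable (at z)"
      using Suc.prems(1) by (intro deriv_funpow_xD_op_differentiable[OF \<open>open S\<close>, of "n - 1"]) auto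
  qed (use Suc.prems in auto)
  then show ?case by (simp add: funpow_swap1)
qed

lemma exp_polynomial_differentiable:
  "exp_polynomial n field_differentiable (at (x::'a::real_normed_field))"
proof -
  have "(\<lambda>x::'a. \<Sum>k=0..n. of_nat (Stirling n k) * x ^ k) field_differentiable (at x)"
    by (intro derivative_intros)
  then show ?thesis by (simp add: exp_polynomial_def[abs_def])
qed

text \<open>In the Stirling recurrence, multiplication by \<open>x\<close> produces the term
  \<open>Stirling n k\<close>, and \<open>xD_op\<close>, which multiplies the coefficient of
  \<open>x ^ k\<close> by \<open>k\<close>, produces the term
  \<open>Suc k * Stirling n (Suc k)\<close>.\<close>

lemma M_hat_exp_polynomial:
  "M_hat (exp_polynomial n) x = exp_polynomial (Suc n) (x::'a::real_normed_field)"
proof -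
  have "((\<lambda>x::'a. \<Sum>k=0..n. of_nat (Stirling n k) * x ^ k) has_field_derivative
      (\<Sum>k=0..n. of_nat (Stirling n k) * (of_nat k * x ^ (k - 1)))) (at x)"
    by (auto intro!: derivative_eq_intros sum.cong simp: mult_ac)
  then have d: "deriv (exp_polynomial n) x
      = (\<Sum>k=0..n. of_nat (Stirling n k) * (of_nat k * x ^ (k - 1)))"
    by (simp add: exp_polynomial_def[abs_def] DERIV_imp_deriv)
  \<comment> \<open>For \<open>k = 0\<close> the truncated exponent \<open>k - 1\<close> does no
    harm, as the factor \<open>of_nat k\<close> is zero.\<close>
  have power: "x * (c * (of_nat k * x ^ (k - 1))) = of_nat k * c * x ^ k" for c k
    by (cases k) auto
  have "x * deriv (exp_polynomial n) x = (\<Sum>k=0..n. of_nat k * of_nat (Stirling n k) * x ^ k)"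
    unfolding d sum_distrib_left by (simp only: power)
  \<comment> \<open>The added term vanishes since \<open>Stirling n (Suc n) = 0\<close>; the term
    for \<open>k = 0\<close> then drops out in the index shift.\<close>
  also have "\<dots> = (\<Sum>k=0..Suc n. of_nat k * of_nat (Stirling n k) * x ^ k)"
    by simp
  also have "\<dots> = (\<Sum>k=0..n. of_nat (Suc k) * of_nat (Stirling n (Suc k)) * x ^ Suc k)"
    by (subst sum.atLeast0_atMost_Suc_shift) simp
  finally have "M_hat (exp_polynomial n) x
      = (\<Sum>k=0..n. of_nat (Stirling (Suc n) (Suc k)) * x ^ Suc k)"
    by (simp add: M_hat_def xD_op_def exp_polynomial_def sum_distrib_left
        flip: sum.distrib) (simp add: algebra_simps)
  also have "\<dots> = exp_polynomial (Suc n) x"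
    unfolding exp_polynomial_def by (subst sum.atLeast0_atMost_Suc_shift) simp
  finally show ?thesis .
qed

text \<open>Pascal's rule in the form of a Leibniz induction step: one more application raises the
  index of either \<open>p\<close> or \<open>g\<close>.\<close>

lemma binomial_sum_Suc:
  fixes p g :: "nat \<Rightarrow> 'a::comm_semiring_1"
  shows "(\<Sum>k=0..Suc n. of_nat (Suc n choose k) * p (Suc n - k) * g k)
    = (\<Sum>k=0..n. of_nat (n choose k) * (p (Suc (n - k)) * g k + p (n - k) * g (Suc k)))"
proof -
  have "(\<Sum>k=0..Suc n. of_nat (Suc n choose k) * p (Suc n - k) * g k)
      = p (Suc n) * g 0
        + (\<Sum>k=0..n. of_nat (n choose Suc k) * p (Suc n - Suc k) * g (Suc k))
        + (\<Sum>k=0..n. of_nat (n choose k) * p (n - k) * g (Suc k))"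
    by (subst sum.atLeast0_atMost_Suc_shift) (simp add: sum.distrib algebra_simps)
  also have "p (Suc n) * g 0 + (\<Sum>k=0..n. of_nat (n choose Suc k) * p (Suc n - Suc k) * g (Suc k))
      = (\<Sum>k=0..Suc n. of_nat (n choose k) * p (Suc n - k) * g k)"
    by (subst sum.atLeast0_atMost_Suc_shift) simp
  \<comment> \<open>The top term vanishes because \<open>n choose Suc n = 0\<close>.\<close>
  also have "\<dots> = (\<Sum>k=0..n. of_nat (n choose k) * p (Suc (n - k)) * g k)"
    by (simp add: Suc_diff_le binomial_eq_0)
  finally show ?thesis by (simp add: sum.distrib algebra_simps)
qed

theorem theorem1:
  fixes f :: "'a::real_normed_field \<Rightarrow> 'a" and S :: "'a set" and n :: nat and x :: 'a
  assumes "open S"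
    and "\<And>k y. k < n \<Longrightarrow> y \<in> S \<Longrightarrow> (deriv ^^ k) f field_differentiable (at y)"
    and "x \<in> S"
  shows "(M_hat ^^ n) f x =
    (\<Sum>k=0..n. of_nat (n choose k) * exp_polynomial (n - k) x * (xD_op ^^ k) f x)"
  using assms(2,3)
proof (induction n arbitrary: x)
  case 0
  then show ?case by (simp add: exp_polynomial_def)
next
  case (Suc n)
  let ?p = "\<lambda>k. exp_polynomial k :: 'a \<Rightarrow> 'a"
  let ?g = "\<lambda>k. (xD_op ^^ k) f"
  let ?F = "\<lambda>y. \<Sum>k=0..n. of_nat (n choose k) * ?p (n - k) y * ?g k y"
  \<comment> \<open>The formula is needed on all of \<open>S\<close>, not only at \<open>x\<close>,
    because it is about to be differentiated.\<close>
  have eq: "(M_hat ^^ n) f y = ?F y" if "y \<in> S" for y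
    using Suc.IH Suc.prems(1) that by simp
  have g: "(?g k has_field_derivative deriv (?g k) x) (at x)" if "k \<le> n" for k
    using xD_op_funpow_differentiable[OF \<open>open S\<close> Suc.prems(1), where k = k and y = x] that Suc.prems(2)
    by (simp add: field_differentiable_derivI)
  have p: "(?p k has_field_derivative deriv (?p k) x) (at x)" for k
    by (simp add: exp_polynomial_differentiable field_differentiable_derivI)
  have "(?F has_field_derivative (\<Sum>k=0..n. of_nat (n choose k) *
      (deriv (?p (n - k)) x * ?g k x + ?p (n - k) x * deriv (?g k) x))) (at x)"
    by (auto intro!: derivative_eq_intros g p sum.cong simp: algebra_simps)
  then have "deriv ((M_hat ^^ n) f) x = (\<Sum>k=0..n. of_nat (n choose k) *
      (deriv (?p (n - k)) x * ?g k x + ?p (n - k) x * deriv (?g k) x))"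
    by (intro DERIV_imp_deriv has_field_derivative_cong_on_open[OF \<open>open S\<close> Suc.prems(2) eq])
  \<comment> \<open>The product rule for \<open>M_hat\<close>: in each summand the multiplication by
    \<open>x\<close> is credited to the polynomial factor, leaving a plain \<open>xD_op\<close> on
    the iterate of \<open>f\<close>.\<close>
  then have "(M_hat ^^ Suc n) f x = (\<Sum>k=0..n. of_nat (n choose k) *
      (M_hat (?p (n - k)) x * ?g k x + ?p (n - k) x * ?g (Suc k) x))"
    by (simp add: M_hat_def[of "(M_hat ^^ n) f"] M_hat_def[of "?p _"] xD_op_def eq[OF Suc.prems(2)]
        sum_distrib_left flip: sum.distrib) (simp add: algebra_simps)
  then show ?case
    by (simp only: M_hat_exp_polynomial binomial_sum_Suc[of n "\<lambda>k. ?p k x" "\<lambda>k. ?g k x"])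
qed

end
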